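(* Let $d\geq 2$ and let $f:\mathbb{N}_0\to\mathbb{N}_0$ be a function with $f(n)=\omega(n^{(d+1)/d})$. For every $n\geq0$ let $S_n=[-f(n),f(n)]^d$ and $\underline{S}=(S_n)_{n\ge0}$. Then for every sequence of activated vertices $\underline{v}$, the burning density $\delta(\underline{S},\underline{v})$ exists and equals $0$.
   Context: $\mathbb{N}_0$ is the set of nonnegative integers. For an integer $a\ge0$, $[-a,a]^d$ denotes the graph on vertex set $[-a,a]^d\subset\mathbb{Z}^d$ in which two vertices are adjacent iff their $L_1$-distance is $1$. Burning process: let $\underline{G}=(G_0,G_1,\dots)$ be graphs with $G_{n-1}$ an induced subgraph of $G_n$ for all $n\ge1$. A sequence of activated vertices is $\underline{v}=(v_n)_{n\ge0}$ with $v_n\in V(G_n)\cup\{\bullet\}$ ($\bullet$ means no vertex is activated). Burning sets: $B_0=\{v_0\}$ (empty if $v_0=\bullet$), and $B_{n+1}=N_{G_{n+1}}[B_n]$ if $v_{n+1}=\bullet$, and $B_{n+1}=N_{G_{n+1}}[B_n]\cup\{v_{n+1}\}$ otherwise, where $N_G[X]$ is the closed neighbourhood of $X$ in $G$. The burning density is $\delta(\underline{G},\underline{v})=\lim_{n\to\infty}|B_n|/|V(G_n)|$ when the limit exists. *)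

theory Defs
  imports "HOL-Analysis.Analysis" "HOL-Library.Landau_Symbols" "Graph_Theory.Graph_Theory"
begin

text \<open>
  Undirected simple graphs are represented as symmetric loop-free digraphs. The closed
  neighbourhood is taken inside the graph, so that it is meaningful for every vertex set;
  for sets of vertices of the graph it is the usual one.
\<close>

definition closed_nbhd :: "'a pair_pre_digraph \<Rightarrow> 'a set \<Rightarrow> 'a set" where
  "closed_nbhd G X = {w \<in> pverts G. \<exists>x\<in>X. w = x \<or> x \<rightarrow>\<^bsub>with_proj G\<^esub> w}"

text \<open>\<^const>\<open>None\<close> stands for a round in which no vertex is activated.\<close>

definition activation_sequence ::
    "(nat \<Rightarrow> 'a pair_pre_digraph) \<Rightarrow> (nat \<Rightarrow> 'a option) \<Rightarrow> bool" where
  "activation_sequence G v \<longleftrightarrow> (\<forall>n. v n \<in> insert None (Some ` pverts (G n)))"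

text \<open>
  The burning process is meant for sequences in which each graph is an induced subgraph of
  the next one, but the recursion does not depend on this.
\<close>

primrec burning_set ::
    "(nat \<Rightarrow> 'a pair_pre_digraph) \<Rightarrow> (nat \<Rightarrow> 'a option) \<Rightarrow> nat \<Rightarrow> 'a set" where
  "burning_set G v 0 = set_option (v 0)"
| "burning_set G v (Suc n) =
     (case v (Suc n) of
        None \<Rightarrow> closed_nbhd (G (Suc n)) (burning_set G v n)
      | Some w \<Rightarrow> closed_nbhd (G (Suc n)) (burning_set G v n) \<union> {w})"

definition has_burning_density ::
    "(nat \<Rightarrow> 'a pair_pre_digraph) \<Rightarrow> (nat \<Rightarrow> 'a option) \<Rightarrow> real \<Rightarrow> bool" where
  "has_burning_density G v \<delta> \<longleftrightarrow>
     (\<lambda>n. real (card (burning_set G v n)) / real (card (pverts (G n)))) \<longlonglongrightarrow> \<delta>"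

definition L1_dist :: "int ^ 'd \<Rightarrow> int ^ 'd \<Rightarrow> int" where
  "L1_dist x y = (\<Sum>i\<in>UNIV. \<bar>x $ i - y $ i\<bar>)"

definition box_vertices :: "nat \<Rightarrow> (int ^ 'd) set" where
  "box_vertices a = {x. \<forall>i. x $ i \<in> {- int a..int a}}"

definition box_graph :: "nat \<Rightarrow> (int ^ 'd) pair_pre_digraph" where
  "box_graph a =
     \<lparr>pverts = box_vertices a,
      parcs = {(x, y) \<in> box_vertices a \<times> box_vertices a. L1_dist x y = 1}\<rparr>"

lemma finite_box_vertices: "finite (box_vertices a :: (int ^ 'd) set)"
proof -
  have "box_vertices a \<subseteq> vec_lambda ` (UNIV \<rightarrow>\<^sub>E {- int a..int a} :: ('d \<Rightarrow> int) set)"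
  proof
    fix x :: "int ^ 'd"
    assume "x \<in> box_vertices a"
    then have "vec_nth x \<in> UNIV \<rightarrow>\<^sub>E {- int a..int a}"
      by (auto simp: box_vertices_def PiE_def)
    then show "x \<in> vec_lambda ` (UNIV \<rightarrow>\<^sub>E {- int a..int a})"
      by (metis imageI vec_nth_inverse)
  qed
  then show ?thesis
    by (rule finite_subset) (intro finite_imageI finite_PiE; simp)
qed

lemma pair_graph_box_graph: "pair_graph (box_graph a :: (int ^ 'd) pair_pre_digraph)"
proof
  show "finite (parcs (box_graph a :: (int ^ 'd) pair_pre_digraph))"
    by (rule finite_subset[of _ "box_vertices a \<times> box_vertices a"])
       (auto simp: box_graph_def finite_box_vertices)
qed (auto simp: box_graph_def finite_box_vertices symmetric_def sym_def L1_dist_def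
       abs_minus_commute)

lemma induced_subgraph_box_graph:
  assumes "a \<le> b"
  shows "induced_subgraph (with_proj (box_graph a :: (int ^ 'd) pair_pre_digraph))
           (with_proj (box_graph b))"
proof -
  interpret A: pair_graph "box_graph a :: (int ^ 'd) pair_pre_digraph"
    by (rule pair_graph_box_graph)
  interpret B: pair_graph "box_graph b :: (int ^ 'd) pair_pre_digraph"
    by (rule pair_graph_box_graph)
  have "box_vertices a \<subseteq> (box_vertices b :: (int ^ 'd) set)"
  proof -
    have "{- int a..int a} \<subseteq> {- int b..int b}"
      using assms by simp
    then show ?thesis
      unfolding box_vertices_def by blast
  qed
  then show ?thesis
    using A.wf_digraph B.wf_digraph
    by (auto simp: induced_subgraph_def subgraph_def compatible_def box_graph_def)
qed

end

theory Submission
  imports Defs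
begin

text \<open>
  Fire spreads at most one unit per round in every coordinate, so \<open>B\<^sub>n\<close> is covered by at most
  \<open>n + 1\<close> cubes of side \<open>2n + 1\<close>, one around each activated vertex. Hence the
  burning ratio is at most \<open>(n + 1) (2n + 1)\<^sup>d / (2f(n) + 1)\<^sup>d\<close>, which is bounded by
  a constant times the \<open>d\<close>-th power of \<open>n\<^bsup>(d+1)/d\<^esup> / f(n)\<close>.
\<close>

lemma card_box_vertices:
  "card (box_vertices a :: (int ^ 'd) set) = (2 * a + 1) ^ CARD('d)"
proof -
  have "bij_betw vec_nth (box_vertices a :: (int ^ 'd) set) (UNIV \<rightarrow>\<^sub>E {- int a..int a})"
    by (rule bij_betwI[where g = vec_lambda]) (auto simp: box_vertices_def PiE_def)
  then have "card (box_vertices a :: (int ^ 'd) set)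
      = card ((UNIV :: 'd set) \<rightarrow>\<^sub>E {- int a..int a})"
    by (rule bij_betw_same_card)
  also have "\<dots> = card {- int a..int a} ^ CARD('d)"
    by (simp add: card_funcsetE)
  also have "card {- int a..int a} = 2 * a + 1"
    by simp
  finally show ?thesis .
qed

lemma mem_box_vertices_iff: "x \<in> box_vertices a \<longleftrightarrow> (\<forall>i. \<bar>x $ i\<bar> \<le> int a)"
proof -
  have "k \<in> {- int a..int a} \<longleftrightarrow> \<bar>k\<bar> \<le> int a" for k
    by auto
  then show ?thesis
    unfolding box_vertices_def by blast
qed

text \<open>One term of a sum of nonnegative terms. This turns adjacency into a bound on each
  coordinate separately, so that cubes can replace L1-balls.\<close>

lemma component_le_L1_dist: "\<bar>x $ i - y $ i\<bar> \<le> L1_dist x y"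
  unfolding L1_dist_def by (rule member_le_sum) auto

text \<open>Fire from \<open>v i\<close> has only had \<open>n - i\<close> rounds to spread; the
  common radius \<open>n\<close> is coarser but costs only a constant factor. Rounds without
  activation contribute the empty union through \<open>set_option\<close>.\<close>

lemma burning_set_box_graph_subset:
  fixes f :: "nat \<Rightarrow> nat" and v :: "nat \<Rightarrow> (int ^ 'd) option"
  shows "burning_set (\<lambda>n. box_graph (f n)) v n
    \<subseteq> (\<Union>i\<le>n. \<Union>x\<in>set_option (v i). (+) x ` box_vertices n)"
proof -
  \<comment> \<open>Membership in a translated cube is phrased through the difference
    \<open>w - x\<close>, so the induction step is a coordinatewise triangle inequality.\<close>
  have covered: "\<exists>i\<le>n. \<exists>x\<in>set_option (v i). w - x \<in> box_vertices n"
    if "w \<in> burning_set (\<lambda>n. box_graph (f n)) v n" for w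
    using that
  proof (induction n arbitrary: w)
    case 0
    then show ?case
      by (auto simp: box_vertices_def)
  next
    case (Suc n)
    let ?B = "burning_set (\<lambda>n. box_graph (f n)) v n"
    have "v (Suc n) = Some w \<or> w \<in> closed_nbhd (box_graph (f (Suc n))) ?B"
      using Suc.prems by (auto split: option.splits)
    then show ?case
    proof
      \<comment> \<open>A newly activated vertex is its own centre, with difference 0.\<close>
      assume "v (Suc n) = Some w"
      then show ?thesis
        by (intro exI[of _ "Suc n"]) (auto simp: box_vertices_def)
    next
      assume "w \<in> closed_nbhd (box_graph (f (Suc n))) ?B"
      then obtain y where y: "y \<in> ?B" "w = y \<or> L1_dist y w = 1"
        by (auto simp: closed_nbhd_def box_graph_def)
      from Suc.IH[OF y(1)] obtain i x
        where ix: "i \<le> n" "x \<in> set_option (v i)" "y - x \<in> box_vertices n"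
        by blast
      have "\<bar>w $ j - x $ j\<bar> \<le> int (Suc n)" for j
      proof -
        have "\<bar>y $ j - w $ j\<bar> \<le> 1"
          using y(2) component_le_L1_dist[of y j w] by auto
        moreover have "\<bar>y $ j - x $ j\<bar> \<le> int n"
          using ix(3) by (simp add: mem_box_vertices_iff)
        ultimately show ?thesis
          by linarith
      qed
      then have "w - x \<in> box_vertices (Suc n)"
        by (simp add: mem_box_vertices_iff)
      with ix show ?thesis
        using le_SucI by blast
    qed
  qed
  show ?thesis
  proof
    fix w
    assume "w \<in> burning_set (\<lambda>n. box_graph (f n)) v n"
    from covered[OF this] obtain i x
      where ix: "i \<le> n" "x \<in> set_option (v i)" "w - x \<in> box_vertices n"
      by blast
    have "w \<in> (+) x ` box_vertices n"
      using ix(3) by (rule rev_image_eqI) simp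
    with ix(1,2) show "w \<in> (\<Union>i\<le>n. \<Union>x\<in>set_option (v i). (+) x ` box_vertices n)"
      by (intro UN_I) auto
  qed
qed

lemma card_burning_set_box_graph_le:
  fixes f :: "nat \<Rightarrow> nat" and v :: "nat \<Rightarrow> (int ^ 'd) option"
  shows "card (burning_set (\<lambda>n. box_graph (f n)) v n) \<le> (n + 1) * (2 * n + 1) ^ CARD('d)"
proof -
  let ?C = "\<lambda>i. \<Union>x\<in>set_option (v i). (+) x ` (box_vertices n :: (int ^ 'd) set)"
  have fin: "finite (?C i)" for i
    by (simp add: finite_box_vertices)
  \<comment> \<open>Either the union is empty or it is a single cube, whose size translation
    preserves.\<close>
  have card_C: "card (?C i) \<le> (2 * n + 1) ^ CARD('d)" for i
    by (cases "v i") (auto simp: card_image card_box_vertices)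
  have "card (burning_set (\<lambda>n. box_graph (f n)) v n) \<le> card (\<Union>i\<le>n. ?C i)"
    using fin by (intro card_mono burning_set_box_graph_subset) blast
  also have "\<dots> \<le> (\<Sum>i\<le>n. card (?C i))"
    by (rule card_UN_le) simp
  also have "\<dots> \<le> (\<Sum>i\<le>n. (2 * n + 1) ^ CARD('d))"
    by (intro sum_mono card_C)
  finally show ?thesis
    by simp
qed

theorem theorem3:
  fixes f :: "nat \<Rightarrow> nat" and S :: "nat \<Rightarrow> (int ^ 'd) pair_pre_digraph"
  assumes "CARD('d) \<ge> 2"
    and "(\<lambda>n. real (f n)) \<in> \<omega>(\<lambda>n. real n powr ((real CARD('d) + 1) / real CARD('d)))"
    and "\<And>n. S n = box_graph (f n)"
  shows "\<forall>v. activation_sequence S v \<longrightarrow> has_burning_density S v 0"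
proof (intro allI impI)
  fix v :: "nat \<Rightarrow> (int ^ 'd) option"
  define d where "d = CARD('d)"
  have d: "d > 0"
    by (simp add: d_def)
  \<comment> \<open>The exponent is chosen so that \<open>g n ^ d\<close> equals
    \<open>n ^ (d + 1)\<close>, the order of the bound on the number of burning vertices.\<close>
  define g where "g = (\<lambda>n. real n powr ((real d + 1) / real d))"
  have S: "S = (\<lambda>n. box_graph (f n))"
    using assms(3) by auto
  have g_small: "g \<in> o(\<lambda>n. real (f n))"
    using assms(2) by (simp add: smallomega_iff_smallo g_def d_def)
  have "((\<lambda>n. 2 * 3 ^ d * (g n / real (f n)) ^ d) \<longlongrightarrow> 2 * 3 ^ d * 0 ^ d) sequentially"
    by (intro tendsto_intros smalloD_tendsto g_small)
  then have lim: "(\<lambda>n. 2 * 3 ^ d * (g n / real (f n)) ^ d) \<longlonglongrightarrow> 0"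
    by (simp only: zero_power[OF d] mult_zero_right)
  \<comment> \<open>Where \<open>f n = 0\<close>, the bound would be the junk value \<open>0\<close>; \<open>g\<close> rules this out.\<close>
  have "\<forall>\<^sub>F n in sequentially. f n > 0 \<and> n > 0"
  proof -
    have "\<forall>\<^sub>F n in sequentially. norm (g n) \<le> 1 * norm (real (f n))"
      by (rule landau_o.smallD[OF g_small]) simp
    moreover have "\<forall>\<^sub>F n in sequentially. n > (0 :: nat)"
      by (rule eventually_gt_at_top)
    ultimately show ?thesis
    proof eventually_elim
      case (elim n)
      have "g n > 0"
        using elim(2) by (simp add: g_def)
      with elim show ?case
        by simp
    qed
  qed
  then have bound: "\<forall>\<^sub>F n in sequentially.
      real (card (burning_set S v n)) / real (card (pverts (S n)))
        \<le> 2 * 3 ^ d * (g n / real (f n)) ^ d"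
  proof eventually_elim
    case (elim n)
    have g_pow: "g n ^ d = real n ^ (d + 1)"
    proof -
      \<comment> \<open>Passing between \<open>powr\<close> and natural powers requires a positive
        base, hence \<open>n > 0\<close>.\<close>
      have "g n ^ d = real n powr ((real d + 1) / real d * real d)"
        using elim by (simp add: g_def powr_realpow[symmetric] powr_powr)
      also have "(real d + 1) / real d * real d = real (d + 1)"
        using d by simp
      also have "real n powr real (d + 1) = real n ^ (d + 1)"
        using elim by (intro powr_realpow) simp
      finally show ?thesis .
    qed
    have "real (card (burning_set S v n)) \<le> real ((n + 1) * (2 * n + 1) ^ d)"
      using card_burning_set_box_graph_le[of f v n] unfolding S d_def of_nat_le_iff .
    also have "\<dots> = (real n + 1) * (2 * real n + 1) ^ d"
      by (simp add: algebra_simps)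
    \<comment> \<open>For \<open>n \<ge> 1\<close>, \<open>n + 1 \<le> 2 * n\<close> and
      \<open>2 * n + 1 \<le> 3 * n\<close>; this is the origin of the constant
      \<open>2 * 3 ^ d\<close>.\<close>
    also have "\<dots> \<le> (2 * real n) * (3 * real n) ^ d"
      using elim by (intro mult_mono power_mono) auto
    also have "\<dots> = 2 * 3 ^ d * g n ^ d"
      by (simp add: g_pow power_mult_distrib)
    finally have num: "real (card (burning_set S v n)) \<le> 2 * 3 ^ d * g n ^ d" .
    \<comment> \<open>Weakening the side length to \<open>f n\<close> loses only a constant factor
      and leaves exactly the ratio \<open>g n / f n\<close>, which tends to 0.\<close>
    have "real (f n) ^ d \<le> (2 * real (f n) + 1) ^ d"
      by (intro power_mono) auto
    also have "\<dots> = real (card (pverts (S n)))"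
      by (simp add: S box_graph_def card_box_vertices d_def add.commute)
    finally have "real (card (burning_set S v n)) / real (card (pverts (S n)))
        \<le> (2 * 3 ^ d * g n ^ d) / real (f n) ^ d"
      using num elim by (intro frac_le) (auto simp: g_def)
    then show ?case
      by (simp add: power_divide)
  qed
  show "has_burning_density S v 0"
    unfolding has_burning_density_def
    by (rule tendsto_sandwich[OF _ bound tendsto_const lim]) simp
qed

end
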